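(* Let $X$ and $Z$ be Hausdorff topological vector spaces, let $C\subseteq Z$ be a convex and pointed cone with nonempty interior and let $K$ be a convex nonempty subset of $X$. Consider a mapping $F:K\times K\times K\to Z$. Assume that $F(x,x,y)\in-C$ for all $x,y\in K$, $x\neq y$. Assume further that $F$ is weakly explicitly $C$-quasiconvex with respect to the second variable, weakly $C$-pseudomonotone with respect to the third variable and weakly $C$-hemicontinuous with respect to the third variable. Then the solution sets of the following two problems coincide: (P) find $x_0\in K$ such that $F(x_0,y,x_0)\notin-\operatorname{int}C$ for all $y\in K$; (D) find $x_0\in K$ such that $F(x_0,y,y)\notin-\operatorname{int}C$ for all $y\in K$.
   Context: All spaces are real. A cone $C$ satisfies $tc\in C$ for all $c\in C$, $t\ge 0$; it is convex if $C+C=C$ and pointed if $C\cap(-C)=\{0\}$ ($C$ is not assumed closed). $\operatorname{int}C$ is the interior of $C$. $F$ is weakly $C$-pseudomonotone with respect to the third variable if for all $x,y\in K$: $F(x,y,x)\notin-\operatorname{int}C$ implies $F(x,y,y)\notin-\operatorname{int}C$. $F$ is weakly explicitly $C$-quasiconvex with respect to the second variable if for all $x,y,z\in K$ with $x\ne y$ and all $t\in\,]0,1[$ one has $F(x,(1-t)x+ty,z)-F(x,x,z)\in-\operatorname{int}C$ or $F(x,(1-t)x+ty,z)-F(x,y,z)\in-\operatorname{int}C$. $F$ is weakly $C$-hemicontinuous with respect to the third variable if for all $x,y\in K$ such that $F(x,y,(1-t)x+ty)\notin-\operatorname{int}C$ for all $t\in\,]0,1]$ one has $F(x,y,x)\notin-\operatorname{int}C$.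 *)

theory Defs
  imports "HOL-Analysis.Analysis"
begin

text \<open>Real topological vector spaces (not necessarily Hausdorff). Joint continuity of scalar
  multiplication is phrased through filters, as the library does for addition in
  \<^class>\<open>topological_monoid_add\<close>.\<close>

class real_topological_vector = real_vector + topological_ab_group_add +
  assumes tendsto_scaleR_Pair:
    "LIM p (nhds (r :: real) \<times>\<^sub>F nhds a). fst p *\<^sub>R snd p :> nhds (r *\<^sub>R a)"

instance real_normed_vector \<subseteq> real_topological_vector
proof
  fix r :: real and a :: 'a
  show "LIM p (nhds r \<times>\<^sub>F nhds a). fst p *\<^sub>R snd p :> nhds (r *\<^sub>R a)"
    by (intro tendsto_scaleR filterlim_fst filterlim_snd)
qed

lemma continuous_on_scaleR_Pair:
  "continuous_on UNIV (\<lambda>p :: real \<times> 'a :: real_topological_vector. fst p *\<^sub>R snd p)"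
proof -
  have "((\<lambda>p. fst p *\<^sub>R snd p) \<longlongrightarrow> r *\<^sub>R a) (at (r, a))" for r :: real and a :: 'a
    by (rule filterlim_mono[OF tendsto_scaleR_Pair order_refl])
       (simp add: at_within_def flip: nhds_prod)
  then show ?thesis by (simp add: continuous_on_def)
qed

text \<open>In the definitions below \<open>-int C\<close> is the pointwise negative \<open>uminus ` interior C\<close>;
  the notation \<open>- interior C\<close> would denote the set complement. The map \<open>F\<close> is total, but only
  its values on \<open>K \<times> K \<times> K\<close> matter.\<close>

definition weakly_pseudomonotone_3 ::
  "'z::real_topological_vector set \<Rightarrow> 'x set \<Rightarrow> ('x \<Rightarrow> 'x \<Rightarrow> 'x \<Rightarrow> 'z) \<Rightarrow> bool" where
  "weakly_pseudomonotone_3 C K F \<longleftrightarrow>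
     (\<forall>x\<in>K. \<forall>y\<in>K. F x y x \<notin> uminus ` interior C \<longrightarrow> F x y y \<notin> uminus ` interior C)"

definition weakly_explicitly_quasiconvex_2 ::
  "'z::real_topological_vector set \<Rightarrow> 'x::real_vector set \<Rightarrow> ('x \<Rightarrow> 'x \<Rightarrow> 'x \<Rightarrow> 'z) \<Rightarrow> bool" where
  "weakly_explicitly_quasiconvex_2 C K F \<longleftrightarrow>
     (\<forall>x\<in>K. \<forall>y\<in>K. \<forall>z\<in>K. x \<noteq> y \<longrightarrow> (\<forall>t\<in>{0<..<1}.
        F x ((1 - t) *\<^sub>R x + t *\<^sub>R y) z - F x x z \<in> uminus ` interior C \<or>
        F x ((1 - t) *\<^sub>R x + t *\<^sub>R y) z - F x y z \<in> uminus ` interior C))"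

definition weakly_hemicontinuous_3 ::
  "'z::real_topological_vector set \<Rightarrow> 'x::real_vector set \<Rightarrow> ('x \<Rightarrow> 'x \<Rightarrow> 'x \<Rightarrow> 'z) \<Rightarrow> bool" where
  "weakly_hemicontinuous_3 C K F \<longleftrightarrow>
     (\<forall>x\<in>K. \<forall>y\<in>K.
        (\<forall>t\<in>{0<..1}. F x y ((1 - t) *\<^sub>R x + t *\<^sub>R y) \<notin> uminus ` interior C) \<longrightarrow>
        F x y x \<notin> uminus ` interior C)"

text \<open>For cones, convexity is the condition \<open>C + C = C\<close> (Minkowski sum).\<close>

lemma cone_set_plus_self_iff_convex:
  assumes "cone C" and "C \<noteq> {}"
  shows "C + C = C \<longleftrightarrow> convex C"
proof -
  have "0 \<in> C" using assms cone_contains_0 by blast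
  then have "C \<subseteq> C + C" by (metis add.right_neutral set_plus_intro subsetI)
  moreover have "C + C \<subseteq> C \<longleftrightarrow> convex C"
    using assms(1) convex_cone[of C] unfolding cone_def by (auto simp: set_plus_def) blast+
  ultimately show ?thesis by blast
qed

end

theory Submission
  imports Defs
begin

text \<open>One inclusion is weak pseudomonotonicity itself. For the other, the Minty trick is used: if
  \<open>x\<^sub>0\<close> solves the dual problem and \<open>y \<in> K\<close> differs from \<open>x\<^sub>0\<close>, the dual condition is tested not
  at \<open>y\<close> but at the points \<open>w = (1 - t) x\<^sub>0 + t y\<close> of the segment, giving \<open>F(x\<^sub>0,w,w) \<notin> -int C\<close>.
  Quasiconvexity in the second variable, with third variable \<open>w\<close>, says that \<open>F(x\<^sub>0,w,w)\<close> minus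
  one of the end values \<open>F(x\<^sub>0,x\<^sub>0,w)\<close> and \<open>F(x\<^sub>0,y,w)\<close> lies in \<open>-int C\<close>. That end value cannot
  lie in \<open>-C\<close>: otherwise \<open>F(x\<^sub>0,w,w)\<close> would lie in \<open>-int C - C \<subseteq> -int C\<close>, an inclusion supplied
  by \<open>interior_add_absorb\<close>. Since \<open>F(x\<^sub>0,x\<^sub>0,w) \<in> -C\<close>, the end value in question is \<open>F(x\<^sub>0,y,w)\<close>,
  which is therefore not in \<open>-int C\<close>. Hemicontinuity then lets \<open>t\<close> tend to \<open>0\<close>.\<close>

text \<open>The translate of \<open>interior S\<close> by an element of \<open>S\<close> is open and, as \<open>S\<close> is closed under
  addition, still contained in \<open>S\<close>.\<close>

lemma interior_add_absorb:
  fixes S :: "'a::topological_ab_group_add set"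
  assumes add: "S + S \<subseteq> S" and u: "u \<in> interior S" and c: "c \<in> S"
  shows "u + c \<in> interior S"
proof (rule interiorI)
  show "open ((\<lambda>x. x - c) -` interior S)"
    by (intro open_vimage open_interior continuous_intros)
  show "u + c \<in> (\<lambda>x. x - c) -` interior S"
    using u by simp
  show "(\<lambda>x. x - c) -` interior S \<subseteq> S"
  proof
    fix x assume "x \<in> (\<lambda>x. x - c) -` interior S"
    then have "x - c \<in> S" using interior_subset by auto
    then have "(x - c) + c \<in> S + S" using c by (rule set_plus_intro)
    then show "x \<in> S" using add by auto
  qed
qed

text \<open>Used contrapositively: this is how non-membership in \<open>-int S\<close> passes from the smaller
  vector \<open>a\<close> to the larger vector \<open>b\<close>.\<close>

lemma neg_interior_add_absorb:
  fixes S :: "'a::topological_ab_group_add set"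
  assumes add: "S + S \<subseteq> S"
    and diff: "a - b \<in> uminus ` interior S" and b: "b \<in> uminus ` S"
  shows "a \<in> uminus ` interior S"
proof -
  obtain u where u: "u \<in> interior S" "a - b = - u" using diff by blast
  obtain c where c: "c \<in> S" "b = - c" using b by blast
  have "a = (a - b) + b" by simp
  also have "\<dots> = - (u + c)" using u(2) c(2) by (metis minus_add_distrib)
  finally have "a = - (u + c)" .
  then show ?thesis using interior_add_absorb[OF add u(1) c(1)] by blast
qed

lemma dual_solution_imp_segment:
  fixes C :: "'z::real_topological_vector set" and K :: "'x::real_vector set"
  assumes add: "C + C \<subseteq> C" and "convex K"
    and diag: "\<And>w. w \<in> K \<Longrightarrow> x \<noteq> w \<Longrightarrow> F x x w \<in> uminus ` C"
    and qc: "weakly_explicitly_quasiconvex_2 C K F"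
    and dual: "\<And>w. w \<in> K \<Longrightarrow> F x w w \<notin> uminus ` interior C"
    and xy: "x \<in> K" "y \<in> K" "x \<noteq> y" and t: "t \<in> {0<..1}"
  shows "F x y ((1 - t) *\<^sub>R x + t *\<^sub>R y) \<notin> uminus ` interior C"
proof (cases "t = 1")
  \<comment> \<open>Quasiconvexity only speaks of \<open>t < 1\<close>; at \<open>t = 1\<close> the claim is the dual condition at \<open>y\<close>.\<close>
  case True
  then show ?thesis using dual xy by simp
next
  case False
  define w where "w = (1 - t) *\<^sub>R x + t *\<^sub>R y"
  have t01: "t \<in> {0<..<1}" using t False by auto
  have w: "w \<in> K"
    unfolding w_def using \<open>convex K\<close> xy t by (intro convexD) auto
  have "w - x = t *\<^sub>R (y - x)" by (simp add: w_def algebra_simps)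
  then have "x \<noteq> w" using xy t by auto
  then have "F x x w \<in> uminus ` C" using diag w by blast
  then have "F x w w - F x x w \<notin> uminus ` interior C"
    using neg_interior_add_absorb[OF add] dual[OF w] by blast
  then have less: "F x w w - F x y w \<in> uminus ` interior C"
    using qc xy w t01 unfolding weakly_explicitly_quasiconvex_2_def w_def by blast
  have "F x y w \<notin> uminus ` interior C"
  proof
    assume "F x y w \<in> uminus ` interior C"
    then have "F x y w \<in> uminus ` C" using interior_subset by blast
    then show False using neg_interior_add_absorb[OF add less] dual[OF w] by blast
  qed
  then show ?thesis by (simp add: w_def)
qed

theorem corollary3p2:
  fixes C :: "'z::{real_topological_vector, t2_space} set"
    and K :: "'x::{real_topological_vector, t2_space} set"
    and F :: "'x \<Rightarrow> 'x \<Rightarrow> 'x \<Rightarrow> 'z"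
  assumes "cone C"
    and "C + C = C"
    and "C \<inter> uminus ` C = {0}"
    and "interior C \<noteq> {}"
    and "convex K"
    and "K \<noteq> {}"
    and "\<And>x y. x \<in> K \<Longrightarrow> y \<in> K \<Longrightarrow> x \<noteq> y \<Longrightarrow> F x x y \<in> uminus ` C"
    and "weakly_explicitly_quasiconvex_2 C K F"
    and "weakly_pseudomonotone_3 C K F"
    and "weakly_hemicontinuous_3 C K F"
  shows "{x0 \<in> K. \<forall>y\<in>K. F x0 y x0 \<notin> uminus ` interior C}
       = {x0 \<in> K. \<forall>y\<in>K. F x0 y y \<notin> uminus ` interior C}"
proof (intro Collect_cong conj_cong refl iffI)
  fix x assume "x \<in> K" and "\<forall>y\<in>K. F x y x \<notin> uminus ` interior C"
  then show "\<forall>y\<in>K. F x y y \<notin> uminus ` interior C"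
    using assms(9) unfolding weakly_pseudomonotone_3_def by blast
next
  fix x assume x: "x \<in> K" and dual: "\<forall>y\<in>K. F x y y \<notin> uminus ` interior C"
  show "\<forall>y\<in>K. F x y x \<notin> uminus ` interior C"
  proof
    fix y assume y: "y \<in> K"
    show "F x y x \<notin> uminus ` interior C"
    proof (cases "x = y")
      case True
      then show ?thesis using dual y by blast
    next
      case False
      have "\<forall>t\<in>{0<..1}. F x y ((1 - t) *\<^sub>R x + t *\<^sub>R y) \<notin> uminus ` interior C"
        using dual_solution_imp_segment[OF eq_refl[OF assms(2)] assms(5) assms(7)[OF x] assms(8) _ x y False]
          dual by blast
      then show ?thesis
        using assms(10) x y unfolding weakly_hemicontinuous_3_def by blast
    qed
  qed
qed

end
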